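(* Let $\mathbf{A}\in\mathbb{C}^{N\times N}$ be non-singular and diagonalizable, let $\mathbf{b}\in\mathbb{C}^N$, and let $\mathbf{r}_n$ denote the GMRES residual at iteration $n$ for $\mathbf{A}\mathbf{x}=\mathbf{b}$. Let $l,m$ be integers with $0<l<l+m<N$. Let $J\in[1,l]$, and consider a set $N_J^{(l)}$ of $J$ harmonic Ritz values at iteration $l$, along with a set $\Lambda_J$ of $J$ eigenvalues of $\mathbf{A}$. Then, for iterations $l$ and $l+m$, $$\frac{\|\mathbf{r}_{l+m}\|_2}{\|\mathbf{r}_l\|_2}\;\le\;\Big(\sum_{\lambda_i\in\Lambda_J^c}\kappa(\lambda_i)\Big)\;\max_{\lambda_i\in\Lambda_J^c}|s_J^l(\lambda_i)|\;\min_{q_m\in\mathcal{P}_m^1}\;\max_{\lambda_i\in\Lambda_J^c}|q_m(\lambda_i)|,$$ with $\Lambda_J^c:=\sigma(\mathbf{A})\setminus\Lambda_J$ and $\kappa(\lambda_i):=\|\hat{\mathbf{v}}_i\|_2\,\|\mathbf{v}_i\|_2$, where $\hat{\mathbf{v}}_i$ and $\mathbf{v}_i\in\mathbb{C}^N$ are the left and right eigenvectors associated with $\lambda_i\in\sigma(\mathbf{A})$, with $\hat{\mathbf{v}}_i^{*}\mathbf{v}_i=1$, and where $$s_J^l(z):=\frac{\prod_{\lambda_j\in\Lambda_J}\left(1-\frac{z}{\lambda_j}\right)}{\prod_{\nu_j^{(l)}\in N_J^{(l)}}\left(1-\frac{z}{\nu_j^{(l)}}\right)}.$$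
   Context: $\sigma(\mathbf{A})$ is the set of eigenvalues of $\mathbf{A}$. $\mathcal{P}_n^1$ is the set of polynomials $q$ of degree at most $n$ with $q(0)=1$. $\|\cdot\|_2$ is the Euclidean norm for vectors. Eigenvectors: writing $\mathbf{A}=\mathbf{V}\,\mathrm{diag}(\lambda_1,\dots,\lambda_N)\,\mathbf{V}^{-1}$, $\mathbf{v}_i$ is the $i$-th column of $\mathbf{V}$ and $\hat{\mathbf{v}}_i^{*}$ is the $i$-th row of $\mathbf{V}^{-1}$. GMRES: given an initial guess $\mathbf{x}_0$ and $\mathbf{r}_0=\mathbf{b}-\mathbf{A}\mathbf{x}_0$, the iterate $\mathbf{x}_n$ minimizes $\|\mathbf{b}-\mathbf{A}\mathbf{x}\|_2$ over $\mathbf{x}\in\mathbf{x}_0+\mathrm{span}\{\mathbf{r}_0,\mathbf{A}\mathbf{r}_0,\dots,\mathbf{A}^{n-1}\mathbf{r}_0\}$, and $\mathbf{r}_n=\mathbf{b}-\mathbf{A}\mathbf{x}_n$. Equivalently $\|\mathbf{r}_n\|_2=\min_{q\in\mathcal{P}_n^1}\|q(\mathbf{A})\mathbf{r}_0\|_2$; $p_n\in\mathcal{P}_n^1$ denotes the polynomial achieving this minimum, so $\mathbf{r}_n=p_n(\mathbf{A})\mathbf{r}_0$. Harmonic Ritz values at iteration $l$: the roots $\nu_1^{(l)},\dots,\nu_l^{(l)}$ of $p_l$. They are non-zero since $p_l(0)=1$, and $p_l(z)=\prod_{j=1}^l(1-z/\nu_j^{(l)})$. *)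

theory Defs
  imports
    "HOL-Analysis.Analysis"
    "HOL-Computational_Algebra.Computational_Algebra"
begin

definition spectrum :: "complex^'n^'n \<Rightarrow> complex set" where
  "spectrum A = {c. \<exists>v. v \<noteq> 0 \<and> A *v v = c *s v}"

definition diag_matrix :: "('n \<Rightarrow> complex) \<Rightarrow> complex^'n^'n" where
  "diag_matrix d = (\<chi> i j. if i = j then d i else 0)"

(* A = V diag(lam) V^{-1}; the eigenvalues are listed by index, so lam may repeat values. *)
definition diagonalizes :: "complex^'n^'n \<Rightarrow> ('n \<Rightarrow> complex) \<Rightarrow> complex^'n^'n \<Rightarrow> bool" where
  "diagonalizes V lam A \<longleftrightarrow> invertible V \<and> A = V ** diag_matrix lam ** matrix_inv V"

definition right_eigvec :: "complex^'n^'n \<Rightarrow> 'n \<Rightarrow> complex^'n" where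
  "right_eigvec V i = column i V"

(* The conjugate transpose of this vector is the i-th row of V^{-1}. *)
definition left_eigvec :: "complex^'n^'n \<Rightarrow> 'n \<Rightarrow> complex^'n" where
  "left_eigvec V i = (\<chi> j. cnj (row i (matrix_inv V) $ j))"

definition eigval_cond :: "complex^'n^'n \<Rightarrow> 'n \<Rightarrow> real" where
  "eigval_cond V i = norm (left_eigvec V i) * norm (right_eigvec V i)"

lemma left_right_eigvec_normalized:
  assumes "invertible V"
  shows "(\<Sum>j\<in>UNIV. cnj (left_eigvec V i $ j) * right_eigvec V i $ j) = 1"
proof -
  have "(matrix_inv V ** V) $ i $ i = 1"
    using someI_ex[OF assms[unfolded invertible_def]]
    by (simp add: matrix_inv_def mat_def)
  then show ?thesis
    by (simp add: left_eigvec_def right_eigvec_def row_def column_def matrix_matrix_mult_def)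
qed

primrec matrix_power :: "complex^'n^'n \<Rightarrow> nat \<Rightarrow> complex^'n^'n" where
  "matrix_power A 0 = mat 1"
| "matrix_power A (Suc k) = A ** matrix_power A k"

definition poly_matrix :: "complex poly \<Rightarrow> complex^'n^'n \<Rightarrow> complex^'n^'n" where
  "poly_matrix q A = (\<chi> i j. \<Sum>k\<le>degree q. coeff q k * matrix_power A k $ i $ j)"

definition residual_polys :: "nat \<Rightarrow> complex poly set" where
  "residual_polys n = {q. degree q \<le> n \<and> poly q 0 = 1}"

(* vec.span is the span over the complex scalars; plain span would be the real span. *)
definition krylov :: "complex^'n^'n \<Rightarrow> complex^'n \<Rightarrow> nat \<Rightarrow> (complex^'n) set" where
  "krylov A r n = vec.span ((\<lambda>k. matrix_power A k *v r) ` {..<n})"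

definition gmres_iterate ::
  "complex^'n^'n \<Rightarrow> complex^'n \<Rightarrow> complex^'n \<Rightarrow> nat \<Rightarrow> complex^'n \<Rightarrow> bool" where
  "gmres_iterate A b x0 n x \<longleftrightarrow>
     is_arg_min (\<lambda>y. norm (b - A *v y)) (\<lambda>y. y \<in> (\<lambda>u. x0 + u) ` krylov A (b - A *v x0) n) x"

definition gmres_poly :: "complex^'n^'n \<Rightarrow> complex^'n \<Rightarrow> nat \<Rightarrow> complex poly \<Rightarrow> bool" where
  "gmres_poly A r0 n p \<longleftrightarrow>
     is_arg_min (\<lambda>q. norm (poly_matrix q A *v r0)) (\<lambda>q. q \<in> residual_polys n) p"

(* The harmonic Ritz values are the multiset proots p of roots of the GMRES polynomial p,
   repeated according to multiplicity; N is a sub-multiset of it. *)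
definition deflation_factor :: "complex set \<Rightarrow> complex multiset \<Rightarrow> complex \<Rightarrow> complex" where
  "deflation_factor L N z = (\<Prod>\<mu>\<in>L. 1 - z / \<mu>) / (\<Prod>\<nu>\<in>#N. 1 - z / \<nu>)"

(* The minimum over q is attained (a best uniform approximation on a finite set from a
   finite-dimensional affine space), so INF is the minimum. *)
definition minmax_value :: "nat \<Rightarrow> complex set \<Rightarrow> real" where
  "minmax_value m S = (INF q\<in>residual_polys m. Max ((\<lambda>z. cmod (poly q z)) ` S))"

end

theory Submission
  imports Defs
begin

unbundle no Formal_Power_Series.fps_syntax

text \<open>
  The polynomial \<open>p\<close> splits as \<open>D * g\<close>, where \<open>D\<close> has the chosen harmonic Ritz values as roots and
  \<open>D(0) = 1\<close>. Exchanging \<open>D\<close> for the polynomial \<open>E\<close> with \<open>E(0) = 1\<close> and roots \<open>Lam\<close> does not raise the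
  degree, so \<open>q * E * g\<close> competes in the minimisation of the residual at step \<open>l + m\<close> for every
  residual polynomial \<open>q\<close> of degree \<open>m\<close>. In the eigenbasis this competitor kills the components in
  \<open>Lam\<close>; on the others it is the component of \<open>p(A) r\<^sub>0\<close> multiplied by \<open>q E / D\<close>, and \<open>E / D\<close> is the
  deflation factor.
\<close>

section \<open>Polynomials in a matrix\<close>

lemma mult_vec_scale: "A *v (c *s v) = c *s (A *v (v :: complex^'n))"
  by (simp add: matrix_vector_mult_def vec_eq_iff sum_distrib_left mult_ac)

lemma mult_vec_sum: "A *v (\<Sum>k\<in>K. f k) = (\<Sum>k\<in>K. A *v (f k :: complex^'n))"
  by (induction K rule: infinite_finite_induct) (simp_all add: matrix_vector_right_distrib)

lemma poly_matrix_mult_vec: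
  "poly_matrix q A *v v = (\<Sum>k\<le>degree q. coeff q k *s (matrix_power A k *v v))"
proof -
  have "(\<Sum>j\<in>UNIV. \<Sum>k\<le>degree q. coeff q k * matrix_power A k $ i $ j * v $ j)
      = (\<Sum>k\<le>degree q. \<Sum>j\<in>UNIV. coeff q k * matrix_power A k $ i $ j * v $ j)" for i
    by (rule sum.swap)
  then show ?thesis
    by (simp add: poly_matrix_def matrix_vector_mult_def vec_eq_iff sum_distrib_left
        sum_distrib_right mult.assoc)
qed

text \<open>Coefficients beyond the degree vanish, so the sum may run to any larger
  \<open>n\<close>; polynomials of different degrees then share one range and can be added
  termwise.\<close>

lemma poly_matrix_mult_vec_bound:
  assumes "degree q \<le> n"
  shows "poly_matrix q A *v v = (\<Sum>k\<le>n. coeff q k *s (matrix_power A k *v v))"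
  unfolding poly_matrix_mult_vec
  using assms by (intro sum.mono_neutral_left) (auto simp: coeff_eq_0 not_le)

text \<open>Horner's rule. It drives the induction on polynomials and splits the constant term off a
  residual polynomial.\<close>

lemma poly_matrix_pCons_mult_vec:
  "poly_matrix (pCons c q) A *v v = c *s v + A *v (poly_matrix q A *v v)"
proof -
  have "poly_matrix (pCons c q) A *v v
      = (\<Sum>k\<le>Suc (degree q). coeff (pCons c q) k *s (matrix_power A k *v v))"
    by (rule poly_matrix_mult_vec_bound) (rule degree_pCons_le)
  also have "\<dots> = c *s v + A *v (poly_matrix q A *v v)"
    by (simp add: sum.atMost_Suc_shift poly_matrix_mult_vec mult_vec_sum
        mult_vec_scale flip: matrix_vector_mul_assoc del: sum.atMost_Suc)
  finally show ?thesis .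
qed

lemma poly_matrix_0_mult_vec [simp]: "poly_matrix 0 A *v v = 0"
  by (simp add: poly_matrix_mult_vec)

lemma poly_matrix_add_mult_vec:
  "poly_matrix (p + q) A *v v = poly_matrix p A *v v + poly_matrix q A *v v"
proof -
  let ?n = "max (degree p) (degree q)"
  have "degree (p + q) \<le> ?n" by (rule degree_add_le_max)
  then show ?thesis
    by (simp add: poly_matrix_mult_vec_bound[where n = ?n] sum.distrib vec.scale_left_distrib)
qed

lemma poly_matrix_smult_mult_vec: "poly_matrix (smult c q) A *v v = c *s (poly_matrix q A *v v)"
  by (simp add: poly_matrix_mult_vec_bound[where n = "degree q"] degree_smult_le vec.scale_sum_right)

lemma poly_matrix_monom_mult_vec: "poly_matrix (monom c k) A *v v = c *s (matrix_power A k *v v)"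
proof -
  have "(\<Sum>j\<le>k. coeff (monom c k) j *s (matrix_power A j *v v))
      = (\<Sum>j\<in>{k}. coeff (monom c k) j *s (matrix_power A j *v v))"
    by (intro sum.mono_neutral_right) auto
  then show ?thesis
    by (simp add: poly_matrix_mult_vec_bound[where n = k] degree_monom_le)
qed

text \<open>The condition on coefficients, unlike \<open>degree h < n\<close>, also fits
  \<open>n = 0\<close>: only the zero polynomial remains, and the span of the empty set is
  \<open>{0}\<close>.\<close>

lemma krylov_eq:
  "krylov A v n = {poly_matrix h A *v v | h. \<forall>k\<ge>n. coeff h k = 0}" (is "_ = ?K")
proof
  have "vec.subspace ?K"
  proof (rule vec.subspaceI)
    show "0 \<in> ?K" by (auto intro!: exI[of _ 0])
    show "x + y \<in> ?K" if xy: "x \<in> ?K" "y \<in> ?K" for x y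
    proof -
      obtain g h where "x = poly_matrix g A *v v" "y = poly_matrix h A *v v"
        "\<forall>k\<ge>n. coeff g k = 0" "\<forall>k\<ge>n. coeff h k = 0" using xy by blast
      then show ?thesis
        by (auto simp: poly_matrix_add_mult_vec intro!: exI[of _ "g + h"])
    qed
    show "c *s x \<in> ?K" if x: "x \<in> ?K" for c x
    proof -
      obtain g where "x = poly_matrix g A *v v" "\<forall>k\<ge>n. coeff g k = 0" using x by blast
      then show ?thesis
        by (auto simp: poly_matrix_smult_mult_vec intro!: exI[of _ "smult c g"])
    qed
  qed
  moreover have "(\<lambda>k. matrix_power A k *v v) ` {..<n} \<subseteq> ?K"
  proof (rule image_subsetI)
    fix k assume "k \<in> {..<n}"
    then show "matrix_power A k *v v \<in> ?K"
      by (intro CollectI exI[of _ "monom 1 k"]) (simp add: poly_matrix_monom_mult_vec)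
  qed
  ultimately show "krylov A v n \<subseteq> ?K"
    unfolding krylov_def by (intro vec.span_minimal)
next
  show "?K \<subseteq> krylov A v n"
  proof clarify
    fix h :: "complex poly" assume h: "\<forall>k\<ge>n. coeff h k = 0"
    show "poly_matrix h A *v v \<in> krylov A v n"
      unfolding poly_matrix_mult_vec krylov_def
    proof (rule vec.span_sum)
      fix k
      show "coeff h k *s (matrix_power A k *v v)
          \<in> vec.span ((\<lambda>k. matrix_power A k *v v) ` {..<n})"
      proof (cases "k < n")
        case True
        then show ?thesis by (intro vec.span_scale vec.span_base) auto
      next
        case False
        then show ?thesis using h by (simp add: vec.span_zero)
      qed
    qed
  qed
qed

section \<open>GMRES residuals\<close>

text \<open>A residual polynomial has the form 1 + z h(z), so its value at \<open>A\<close> applied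
  to the initial residual is the residual of the admissible point \<open>x0\<close> -
  h(A)(\<open>b - A *v x0\<close>).\<close>

lemma gmres_residual_le:
  assumes "gmres_iterate A b x0 n x" "q \<in> residual_polys n"
  shows "norm (b - A *v x) \<le> norm (poly_matrix q A *v (b - A *v x0))"
proof -
  obtain c h where q: "q = pCons c h" by (cases q)
  have c: "c = 1" using assms(2) by (simp add: q residual_polys_def)
  have "coeff h k = 0" if "n \<le> k" for k
  proof -
    \<comment> \<open>Index shift: \<open>h\<close> is \<open>q\<close> without its constant term,
      so \<open>degree q \<le> n\<close> leaves \<open>h\<close> only coefficients below
      \<open>n\<close>.\<close>
    have "coeff q (Suc k) = 0"
      using assms(2) that by (intro coeff_eq_0) (simp add: residual_polys_def)
    then show ?thesis by (simp add: q)
  qed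
  then have "poly_matrix (smult (-1) h) A *v (b - A *v x0) \<in> krylov A (b - A *v x0) n"
    unfolding krylov_eq by (intro CollectI exI[of _ "smult (-1) h"]) simp
  then have "norm (b - A *v x)
      \<le> norm (b - A *v (x0 + poly_matrix (smult (-1) h) A *v (b - A *v x0)))"
    using assms(1) unfolding gmres_iterate_def is_arg_min_linorder by blast
  also have "b - A *v (x0 + poly_matrix (smult (-1) h) A *v (b - A *v x0))
      = poly_matrix q A *v (b - A *v x0)"
    by (simp only: q c poly_matrix_pCons_mult_vec poly_matrix_smult_mult_vec
        matrix_vector_right_distrib mult_vec_scale) simp
  finally show ?thesis .
qed

text \<open>The converse correspondence: a correction h(A)(\<open>b - A *v x0\<close>) from the
  Krylov space yields the residual polynomial 1 - z h(z), against which \<open>p\<close> is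
  minimal.\<close>

lemma gmres_poly_norm_le:
  assumes "gmres_iterate A b x0 n x" "gmres_poly A (b - A *v x0) n p"
  shows "norm (poly_matrix p A *v (b - A *v x0)) \<le> norm (b - A *v x)"
proof -
  obtain u where x: "x = x0 + u" and "u \<in> krylov A (b - A *v x0) n"
    using assms(1) unfolding gmres_iterate_def is_arg_min_linorder by blast
  then obtain h where u: "u = poly_matrix h A *v (b - A *v x0)"
    and h: "\<forall>k\<ge>n. coeff h k = 0"
    unfolding krylov_eq by blast
  have "degree (pCons 1 (smult (-1) h)) \<le> n"
    using h by (intro degree_le) (auto simp: coeff_pCons split: nat.split)
  then have "pCons 1 (smult (-1) h) \<in> residual_polys n"
    by (simp add: residual_polys_def)
  then have "norm (poly_matrix p A *v (b - A *v x0))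
      \<le> norm (poly_matrix (pCons 1 (smult (-1) h)) A *v (b - A *v x0))"
    using assms(2) unfolding gmres_poly_def is_arg_min_linorder by blast
  also have "poly_matrix (pCons 1 (smult (-1) h)) A *v (b - A *v x0) = b - A *v x"
    by (simp only: x u poly_matrix_pCons_mult_vec poly_matrix_smult_mult_vec
        matrix_vector_right_distrib mult_vec_scale) simp
  finally show ?thesis .
qed

section \<open>Diagonalizable matrices\<close>

lemma matrix_inv_mult_vec:
  fixes V :: "complex^'n^'n"
  assumes "invertible V"
  shows "matrix_inv V *v (V *v v) = v" "V *v (matrix_inv V *v v) = v"
  \<comment> \<open>\<open>matrix_inv\<close> is a Hilbert choice; invertibility makes the chosen
    matrix a two-sided inverse.\<close>
  using someI_ex[OF assms[unfolded invertible_def]]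
  by (simp_all add: matrix_inv_def matrix_vector_mul_assoc)

lemma diagonalizes_mult_vec:
  assumes "diagonalizes V lam A"
  shows "A *v (V *v c) = V *v (\<chi> i. lam i * c $ i)"
proof -
  have "diag_matrix lam *v c = (\<chi> i. lam i * c $ i)"
    by (simp add: diag_matrix_def matrix_vector_mult_def vec_eq_iff if_distrib[of "\<lambda>x. x * _"]
        cong: if_cong)
  then show ?thesis
    using assms by (simp add: diagonalizes_def matrix_inv_mult_vec flip: matrix_vector_mul_assoc)
qed

lemma poly_matrix_diagonalizes:
  assumes "diagonalizes V lam A"
  shows "poly_matrix q A *v (V *v c) = V *v (\<chi> i. poly q (lam i) * c $ i)"
proof (induction q)
  case 0
  show ?case by (simp flip: zero_vec_def)
next
  case (pCons a q)
  have "poly_matrix (pCons a q) A *v (V *v c)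
      = V *v (a *s c + (\<chi> i. lam i * (poly q (lam i) * c $ i)))"
    by (simp add: poly_matrix_pCons_mult_vec pCons.IH diagonalizes_mult_vec[OF assms]
        matrix_vector_right_distrib mult_vec_scale)
  also have "a *s c + (\<chi> i. lam i * (poly q (lam i) * c $ i))
      = (\<chi> i. poly (pCons a q) (lam i) * c $ i)"
    by (simp add: vec_eq_iff algebra_simps)
  finally show ?case .
qed

lemma spectrum_diagonalizes:
  assumes "diagonalizes V lam A"
  shows "spectrum A = range lam"
proof
  have V: "invertible V" using assms by (simp add: diagonalizes_def)
  show "spectrum A \<subseteq> range lam"
  proof
    fix z assume "z \<in> spectrum A"
    then obtain v where v: "v \<noteq> 0" "A *v v = z *s v" by (auto simp: spectrum_def)
    define c where "c = matrix_inv V *v v"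
    have vc: "v = V *v c" by (simp add: c_def matrix_inv_mult_vec[OF V])
    have "c \<noteq> 0" using v(1) vc by auto
    then obtain i where i: "c $ i \<noteq> 0" by (auto simp: vec_eq_iff)
    \<comment> \<open>In eigenbasis coordinates the eigenvalue equation decouples; a nonzero
      coordinate of \<open>c\<close> then identifies \<open>z\<close>.\<close>
    have "V *v (\<chi> i. lam i * c $ i) = V *v (z *s c)"
      using v(2) unfolding vc diagonalizes_mult_vec[OF assms]
      by (simp add: mult_vec_scale)
    then have "(\<chi> i. lam i * c $ i) = z *s c"
      by (metis matrix_inv_mult_vec(1)[OF V])
    then have "lam i * c $ i = z * c $ i" by (simp add: vec_eq_iff)
    then show "z \<in> range lam" using i by auto
  qed
  show "range lam \<subseteq> spectrum A"
  proof (rule image_subsetI)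
    fix i
    have "(\<chi> j. lam j * axis i 1 $ j) = lam i *s axis i 1"
      by (simp add: vec_eq_iff axis_def)
    then have "A *v (V *v axis i 1) = lam i *s (V *v axis i 1)"
      by (simp add: diagonalizes_mult_vec[OF assms] mult_vec_scale)
    moreover have "V *v axis i 1 \<noteq> 0"
    proof
      assume "V *v axis i 1 = 0"
      then have "matrix_inv V *v (V *v axis i 1) = 0" by simp
      then show False by (simp add: matrix_inv_mult_vec[OF V])
    qed
    ultimately show "lam i \<in> spectrum A" by (auto simp: spectrum_def)
  qed
qed

lemma zero_notin_spectrum:
  assumes "invertible A"
  shows "0 \<notin> spectrum A"
proof
  assume "0 \<in> spectrum A"
  then obtain v where "v \<noteq> 0" "A *v v = 0" by (auto simp: spectrum_def)
  then show False using matrix_inv_mult_vec(1)[OF assms, of v] by simp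
qed

lemma norm_vec_scale: "norm (c *s v) = cmod c * norm (v :: complex^'n)"
  by (simp add: norm_vec_def norm_mult L2_set_right_distrib)

lemma norm_mult_vec_le:
  fixes V :: "complex^'n^'n"
  shows "norm (V *v c) \<le> (\<Sum>i\<in>UNIV. cmod (c $ i) * norm (right_eigvec V i))"
  unfolding matrix_mult_sum right_eigvec_def
  by (rule order.trans[OF norm_sum]) (simp add: norm_vec_scale)

text \<open>Cauchy-Schwarz: an eigenbasis coordinate of \<open>v\<close> is its inner product with a
  left eigenvector.\<close>

lemma norm_matrix_inv_component_le:
  "cmod ((matrix_inv V *v v) $ i) \<le> norm (left_eigvec V i) * norm v"
proof -
  have "cmod ((matrix_inv V *v v) $ i)
      \<le> (\<Sum>j\<in>UNIV. \<bar>cmod (matrix_inv V $ i $ j)\<bar> * \<bar>cmod (v $ j)\<bar>)"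
    unfolding matrix_vector_mult_def
    by (simp add: order.trans[OF norm_sum] norm_mult)
  also have "\<dots> \<le> L2_set (\<lambda>j. cmod (matrix_inv V $ i $ j)) UNIV * L2_set (\<lambda>j. cmod (v $ j)) UNIV"
    by (rule L2_set_mult_ineq)
  also have "\<dots> = norm (left_eigvec V i) * norm v"
    by (simp add: norm_vec_def left_eigvec_def row_def)
  finally show ?thesis .
qed

text \<open>The coordinates of p(A)v are controlled by left eigenvectors, and the expansion of t(A)v
  by right ones; together they form \<open>eigval_cond\<close>. Domination by \<open>f\<close>
  replaces the quotient t/p, since \<open>p\<close> may vanish at an eigenvalue.\<close>

lemma norm_poly_matrix_le:
  assumes "diagonalizes V lam A"
    and "\<And>i. cmod (poly t (lam i)) \<le> f i * cmod (poly p (lam i))"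
    and "\<And>i. 0 \<le> f i"
  shows "norm (poly_matrix t A *v v)
    \<le> (\<Sum>i\<in>UNIV. f i * eigval_cond V i) * norm (poly_matrix p A *v v)"
proof -
  have V: "invertible V" using assms(1) by (simp add: diagonalizes_def)
  define c where "c = matrix_inv V *v v"
  have v: "v = V *v c" by (simp add: c_def matrix_inv_mult_vec[OF V])
  have p: "cmod (poly p (lam i) * c $ i) \<le> norm (left_eigvec V i) * norm (poly_matrix p A *v v)"
    for i
    using norm_matrix_inv_component_le[of V "poly_matrix p A *v v" i]
    by (simp add: v poly_matrix_diagonalizes[OF assms(1)] matrix_inv_mult_vec[OF V])
  have "norm (poly_matrix t A *v v)
      \<le> (\<Sum>i\<in>UNIV. cmod (poly t (lam i) * c $ i) * norm (right_eigvec V i))"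
    using norm_mult_vec_le[of V "\<chi> i. poly t (lam i) * c $ i"]
    by (simp add: v poly_matrix_diagonalizes[OF assms(1)])
  also have "\<dots> \<le> (\<Sum>i\<in>UNIV. (f i * eigval_cond V i) * norm (poly_matrix p A *v v))"
  proof (rule sum_mono)
    fix i
    have "cmod (poly t (lam i) * c $ i) \<le> f i * cmod (poly p (lam i)) * cmod (c $ i)"
      unfolding norm_mult by (intro mult_right_mono assms) simp
    also have "\<dots> = f i * cmod (poly p (lam i) * c $ i)"
      by (simp add: norm_mult)
    also have "\<dots> \<le> f i * (norm (left_eigvec V i) * norm (poly_matrix p A *v v))"
      by (intro mult_left_mono p assms)
    finally have "cmod (poly t (lam i) * c $ i) * norm (right_eigvec V i)
        \<le> f i * (norm (left_eigvec V i) * norm (poly_matrix p A *v v)) * norm (right_eigvec V i)"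
      by (rule mult_right_mono) simp
    then show "cmod (poly t (lam i) * c $ i) * norm (right_eigvec V i)
        \<le> (f i * eigval_cond V i) * norm (poly_matrix p A *v v)"
      by (simp add: eigval_cond_def mult_ac)
  qed
  finally show ?thesis by (simp add: sum_distrib_right)
qed

section \<open>The deflated polynomial\<close>

text \<open>Over the complex numbers \<open>p\<close> splits, and \<open>poly p 0 = 1\<close> keeps
  its roots away from 0. Hence each z - \<nu> with \<nu> in \<open>M\<close> can be rescaled to 1 -
  z/\<nu>, while \<open>g\<close> absorbs the constants and the other roots.\<close>

lemma complex_poly_split_proots:
  fixes p :: "complex poly"
  assumes "M \<subseteq># proots p" "poly p 0 = 1"
  obtains g where "\<And>z. poly p z = (\<Prod>\<nu>\<in>#M. 1 - z / \<nu>) * poly g z"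
    and "degree g + size M = degree p" and "poly g 0 = 1"
proof -
  have p0: "p \<noteq> 0" using assms(2) by auto
  then have nz: "\<nu> \<noteq> 0" if "\<nu> \<in># proots p" for \<nu>
    using that assms(2) by auto
  define N where "N = proots p - M"
  have pMN: "proots p = M + N" using assms(1) by (simp add: N_def)
  define c where "c = lead_coeff p * (\<Prod>\<nu>\<in>#M. - \<nu>)"
  define g where "g = smult c (\<Prod>\<nu>\<in>#N. [:-\<nu>, 1:])"
  have split: "(\<Prod>\<nu>\<in>#M. z - \<nu>) = (\<Prod>\<nu>\<in>#M. - \<nu>) * (\<Prod>\<nu>\<in>#M. 1 - z / \<nu>)" for z
  proof -
    have "(\<Prod>\<nu>\<in>#M. z - \<nu>) = (\<Prod>\<nu>\<in>#M. - \<nu> * (1 - z / \<nu>))"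
      using nz by (intro arg_cong[where f = prod_mset] image_mset_cong) (auto simp: pMN field_simps)
    then show ?thesis by (simp only: prod_mset.distrib)
  qed
  have "poly p z = (\<Prod>\<nu>\<in>#M. 1 - z / \<nu>) * poly g z" for z
  proof -
    have "poly p z = poly (smult (lead_coeff p) (\<Prod>\<nu>\<in>#proots p. [:-\<nu>, 1:])) z"
      by (simp only: complex_poly_decompose_multiset)
    also have "\<dots> = lead_coeff p * ((\<Prod>\<nu>\<in>#M. z - \<nu>) * (\<Prod>\<nu>\<in>#N. z - \<nu>))"
      by (simp add: pMN poly_prod_mset)
    finally show ?thesis by (simp add: split g_def c_def poly_prod_mset)
  qed
  moreover have "poly g 0 = 1" using calculation[of 0] assms(2) by simp
  moreover have "degree g + size M = degree p"
  proof -
    \<comment> \<open>A nonzero constant leaves the degree unchanged, so \<open>g\<close> has as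
      many roots as \<open>N\<close> has elements.\<close>
    have "c \<noteq> 0" using \<open>poly g 0 = 1\<close> by (auto simp: g_def)
    moreover have "degree (\<Prod>\<nu>\<in>#K. [:-\<nu>, 1:]) = size K" for K :: "complex multiset"
    proof (induction K)
      case (add \<nu> K)
      then show ?case
        by (subst image_mset_add_mset, subst prod_mset.add_mset, subst degree_mult_eq)
          auto
    qed simp
    ultimately have "degree g = size N" by (simp add: g_def)
    then show ?thesis using size_proots_complex[of p] by (simp add: pMN)
  qed
  ultimately show thesis using that by blast
qed

lemma residual_poly_with_roots:
  fixes L :: "'a::field set"
  assumes "0 \<notin> L"
  obtains e where "\<And>z. poly e z = (\<Prod>\<mu>\<in>L. 1 - z / \<mu>)" and "degree e \<le> card L" and "poly e 0 = 1"
proof (rule that)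
  let ?e = "\<Prod>\<mu>\<in>L. [:1, - (1 / \<mu>):]"
  show e: "poly ?e z = (\<Prod>\<mu>\<in>L. 1 - z / \<mu>)" for z by (simp add: poly_prod)
  show "poly ?e 0 = 1" by (simp add: poly_prod)
  show "degree ?e \<le> card L"
  proof (cases "finite L")
    case True
    have "degree ?e \<le> (\<Sum>\<mu>\<in>L. degree [:1, - (1 / \<mu>):])"
      using degree_prod_sum_le[OF True, of "\<lambda>\<mu>. [:1, - (1 / \<mu>):]"] by (simp add: o_def)
    also have "\<dots> \<le> (\<Sum>\<mu>\<in>L. 1)" by (intro sum_mono) simp
    finally show ?thesis by simp
  qed simp
qed

lemma gmres_residual_deflation:
  assumes A: "invertible A" "diagonalizes V lam A"
    and iter: "gmres_iterate A b x0 l y" "gmres_iterate A b x0 (l + m) y'"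
    and p: "gmres_poly A (b - A *v x0) l p"
    and L: "Lam \<subseteq> spectrum A"
    and R: "Ritz \<subseteq># proots p" "size Ritz = card Lam" "\<And>\<nu>. \<nu> \<in># Ritz \<Longrightarrow> \<nu> \<notin> spectrum A - Lam"
    and q: "q \<in> residual_polys m"
  shows "norm (b - A *v y') \<le> (\<Sum>i | lam i \<in> spectrum A - Lam.
      cmod (deflation_factor Lam Ritz (lam i)) * cmod (poly q (lam i)) * eigval_cond V i)
      * norm (b - A *v y)"
proof -
  let ?S = "spectrum A - Lam" and ?r = "b - A *v x0"
  \<comment> \<open>The weight is 0 at eigenvalues in \<open>Lam\<close>, where the competitor
    vanishes; this restricts the final sum to the complement.\<close>
  let ?f = "\<lambda>i. if lam i \<in> ?S
    then cmod (deflation_factor Lam Ritz (lam i)) * cmod (poly q (lam i)) else 0"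
  have spec: "spectrum A = range lam" by (rule spectrum_diagonalizes[OF A(2)])
  have L0: "0 \<notin> Lam" using L zero_notin_spectrum[OF A(1)] by auto
  have finL: "finite Lam" using L finite_subset[of Lam "range lam"] by (simp add: spec)
  have p0: "poly p 0 = 1" and deg_p: "degree p \<le> l"
    using p by (auto simp: gmres_poly_def is_arg_min_def residual_polys_def)
  obtain g where g: "\<And>z. poly p z = (\<Prod>\<nu>\<in>#Ritz. 1 - z / \<nu>) * poly g z"
    and deg_g: "degree g + size Ritz = degree p" and g0: "poly g 0 = 1"
    using complex_poly_split_proots[OF R(1) p0] by blast
  obtain e where e: "\<And>z. poly e z = (\<Prod>\<mu>\<in>Lam. 1 - z / \<mu>)" and deg_e: "degree e \<le> card Lam"
    and e0: "poly e 0 = 1"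
    using residual_poly_with_roots[OF L0] by blast
  define t where "t = q * (e * g)"
  \<comment> \<open>Degree count: \<open>e\<close> adds at most \<open>card Lam\<close>, exactly
    what removing the roots in \<open>Ritz\<close> saved, so the total is at most
    \<open>l + m\<close>.\<close>
  have "degree t \<le> degree q + (degree e + degree g)"
    unfolding t_def by (meson add_left_mono degree_mult_le order.trans)
  moreover have "degree q \<le> m" "poly q 0 = 1" using q by (auto simp: residual_polys_def)
  ultimately have t: "t \<in> residual_polys (l + m)"
    using deg_p deg_g deg_e R(2) g0 e0 by (simp add: residual_polys_def t_def)
  have t_le: "cmod (poly t (lam i)) \<le> ?f i * cmod (poly p (lam i))" for i
  proof (cases "lam i \<in> ?S")
    case True
    \<comment> \<open>A zero factor would force \<open>\<nu>\<close> to equal \<open>lam i\<close>,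
      an eigenvalue outside \<open>Lam\<close>.\<close>
    have "1 - lam i / \<nu> \<noteq> 0" if "\<nu> \<in># Ritz" for \<nu>
      using R(3)[OF that] True by auto
    then have "(\<Prod>\<nu>\<in>#Ritz. 1 - lam i / \<nu>) \<noteq> 0"
      unfolding prod_mset_zero_iff by fastforce
    then have "poly t (lam i) = deflation_factor Lam Ritz (lam i) * poly q (lam i) * poly p (lam i)"
      by (simp add: t_def g e deflation_factor_def)
    then show ?thesis using True by (simp add: norm_mult)
  next
    case False
    then have "lam i \<in> Lam" by (auto simp: spec)
    then have "poly e (lam i) = 0" using finL L0 by (auto simp: e)
    then show ?thesis using False by (simp add: t_def)
  qed
  have "norm (b - A *v y') \<le> norm (poly_matrix t A *v ?r)"
    by (rule gmres_residual_le[OF iter(2) t])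
  also have "\<dots> \<le> (\<Sum>i\<in>UNIV. ?f i * eigval_cond V i) * norm (poly_matrix p A *v ?r)"
    by (rule norm_poly_matrix_le[OF A(2) t_le]) simp
  also have "\<dots> \<le> (\<Sum>i\<in>UNIV. ?f i * eigval_cond V i) * norm (b - A *v y)"
    by (intro mult_left_mono gmres_poly_norm_le[OF iter(1) p] sum_nonneg)
      (simp add: eigval_cond_def)
  also have "(\<Sum>i\<in>UNIV. ?f i * eigval_cond V i) = (\<Sum>i | lam i \<in> ?S.
      cmod (deflation_factor Lam Ritz (lam i)) * cmod (poly q (lam i)) * eigval_cond V i)"
    by (intro sum.mono_neutral_cong_right) auto
  finally show ?thesis .
qed

text \<open>For positive \<open>C\<close>, dividing by \<open>C\<close> makes a / C a lower bound of
  the set whose infimum is taken. For \<open>C = 0\<close> a single instance is enough.\<close>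

lemma le_mult_minmax_value:
  assumes "0 \<le> C" and "\<And>q. q \<in> residual_polys m \<Longrightarrow> a \<le> C * Max ((\<lambda>z. cmod (poly q z)) ` S)"
  shows "a \<le> C * minmax_value m S"
proof -
  \<comment> \<open>The constant 1 shows that the infimum is over a nonempty set, and it is the
    instance for \<open>C = 0\<close>.\<close>
  have one: "1 \<in> residual_polys m" by (simp add: residual_polys_def)
  show ?thesis
  proof (cases "C = 0")
    case True
    then show ?thesis using assms(2)[OF one] by simp
  next
    case False
    then have "a / C \<le> minmax_value m S"
      unfolding minmax_value_def using assms one
      by (intro cINF_greatest) (auto simp: field_simps)
    then show ?thesis using False assms(1) by (simp add: field_simps)
  qed
qed

theorem theorem2p6:
  fixes A V :: "complex^'n^'n"
    and b x0 :: "complex^'n"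
    and lam :: "'n \<Rightarrow> complex"
    and x r :: "nat \<Rightarrow> complex^'n"
    and p :: "complex poly"
    and l m J :: nat
    and Lam :: "complex set"
    and Ritz :: "complex multiset"
  assumes "invertible A"
    and "diagonalizes V lam A"
    and "\<And>n. gmres_iterate A b x0 n (x n)"
    and "\<And>n. r n = b - A *v x n"
    and "0 < l" and "l < l + m" and "l + m < CARD('n)"
    and "1 \<le> J" and "J \<le> l"
    and "gmres_poly A (b - A *v x0) l p"
    and "Ritz \<subseteq># proots p" and "size Ritz = J"
    and "Lam \<subseteq> spectrum A" and "card Lam = J"
    \<comment> \<open>the quotient defining s is well defined on the complement of Lam\<close>
    and "\<And>\<nu>. \<nu> \<in># Ritz \<Longrightarrow> \<nu> \<notin> spectrum A - Lam"
  shows "norm (r (l + m)) / norm (r l)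
    \<le> (\<Sum>i | lam i \<in> spectrum A - Lam. eigval_cond V i)
      * Max ((\<lambda>z. cmod (deflation_factor Lam Ritz z)) ` (spectrum A - Lam))
      * minmax_value m (spectrum A - Lam)"
proof -
  let ?S = "spectrum A - Lam"
  let ?K = "\<Sum>i | lam i \<in> ?S. eigval_cond V i"
  let ?s = "\<lambda>z. cmod (deflation_factor Lam Ritz z)"
  have resid: "norm (r (l + m)) \<le> (\<Sum>i | lam i \<in> ?S.
      ?s (lam i) * cmod (poly q (lam i)) * eigval_cond V i) * norm (r l)"
    if "q \<in> residual_polys m" for q
    unfolding assms(4) using that assms
    by (intro gmres_residual_deflation[where p = p]) auto
  show ?thesis
  proof (cases "?S = {}")
    case True
    \<comment> \<open>\<open>Max {}\<close> and \<open>minmax_value m {}\<close> are junk, but they meet the factor 0.\<close>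
    have "norm (r (l + m)) \<le> 0"
      using resid[of 1] by (simp add: True residual_polys_def)
    then show ?thesis by (simp add: True)
  next
    case False
    have fin: "finite ?S" by (simp add: spectrum_diagonalizes[OF assms(2)])
    have K: "0 \<le> ?K" by (intro sum_nonneg) (simp add: eigval_cond_def)
    obtain z where "z \<in> ?S" using False by blast
    then have M: "0 \<le> Max (?s ` ?S)"
      using fin by (intro order.trans[OF norm_ge_zero Max_ge[of _ "?s z"]]) auto
    show ?thesis
    proof (rule le_mult_minmax_value)
      show "0 \<le> ?K * Max (?s ` ?S)" using K M by simp
      fix q assume q: "q \<in> residual_polys m"
      let ?Q = "Max ((\<lambda>z. cmod (poly q z)) ` ?S)"
      have Q: "0 \<le> ?Q"
        using fin \<open>z \<in> ?S\<close> by (intro order.trans[OF norm_ge_zero Max_ge[of _ "cmod (poly q z)"]]) auto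
      \<comment> \<open>Both factors are replaced by their maxima over the eigenvalues. The sum
        stays over indices, so a repeated eigenvalue contributes one condition number per
        index.\<close>
      have "(\<Sum>i | lam i \<in> ?S. ?s (lam i) * cmod (poly q (lam i)) * eigval_cond V i)
          \<le> (\<Sum>i | lam i \<in> ?S. Max (?s ` ?S) * ?Q * eigval_cond V i)"
        using fin M Q by (intro sum_mono mult_right_mono mult_mono) (auto simp: eigval_cond_def)
      also have "\<dots> = ?K * Max (?s ` ?S) * ?Q"
        by (subst sum_distrib_left[symmetric]) (simp only: mult_ac)
      finally have bound: "(\<Sum>i | lam i \<in> ?S. ?s (lam i) * cmod (poly q (lam i)) * eigval_cond V i)
          \<le> ?K * Max (?s ` ?S) * ?Q" .
      show "norm (r (l + m)) / norm (r l) \<le> ?K * Max (?s ` ?S) * ?Q"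
      proof (cases "r l = 0")
        case True
        \<comment> \<open>Division by zero gives 0 here, so nonnegativity of the right-hand side is
          enough.\<close>
        then show ?thesis using K M Q by simp
      next
        case False
        then have "norm (r (l + m)) / norm (r l)
            \<le> (\<Sum>i | lam i \<in> ?S. ?s (lam i) * cmod (poly q (lam i)) * eigval_cond V i)"
          using resid[OF q] by (simp add: divide_le_eq)
        then show ?thesis using bound by simp
      qed
    qed
  qed
qed

end
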